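(* Let $n\ge 1$ and $0\le k\le n$ be integers. The number $F^n_{n-k}$ of maximal rook placements with exactly $n-k$ rooks on the triangular board $\Psi_{1,\ldots,1}$ of size $n$ is $$F_{n-k}^n = k!\sum_{i=k}^{n-k} S(i,k)\cdot S(n+1-i,k+1).$$
   Context: The triangular board $\Psi_{1,\ldots,1}$ of size $n$ is the set of squares $\{(i,j): 1\le i\le j\le n\}$, where $i$ is the column and $j$ is the row (row $j$ has length $j$). A rook placement is a set of squares, no two in the same row and no two in the same column; it is maximal if no further square of the board can be added to it so that it remains a rook placement. $S(m,r)$ is the Stirling number of the second kind, the number of partitions of an $m$-element set into $r$ nonempty blocks ($S(0,0)=1$). A sum whose lower limit exceeds its upper limit is $0$. *)

theory Defs
  imports "HOL-Combinatorics.Stirling"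
begin

text \<open>A square is a pair \<open>(i, j)\<close> where \<open>i\<close> is the column and \<open>j\<close> is the row.\<close>

definition triangular_board :: "nat \<Rightarrow> (nat \<times> nat) set" where
  "triangular_board n = {(i, j). 1 \<le> i \<and> i \<le> j \<and> j \<le> n}"

definition rook_placement :: "(nat \<times> nat) set \<Rightarrow> (nat \<times> nat) set \<Rightarrow> bool" where
  "rook_placement B P \<longleftrightarrow>
     P \<subseteq> B \<and> (\<forall>s\<in>P. \<forall>t\<in>P. s \<noteq> t \<longrightarrow> fst s \<noteq> fst t \<and> snd s \<noteq> snd t)"

definition maximal_rook_placement :: "(nat \<times> nat) set \<Rightarrow> (nat \<times> nat) set \<Rightarrow> bool" where
  "maximal_rook_placement B P \<longleftrightarrow>
     rook_placement B P \<and> (\<forall>s\<in>B - P. \<not> rook_placement B (insert s P))"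

definition num_maximal_placements :: "nat \<Rightarrow> nat \<Rightarrow> nat" where
  "num_maximal_placements n r =
     card {P. maximal_rook_placement (triangular_board n) P \<and> card P = r}"

end

theory Submission
  imports Defs
begin

text \<open>A placement is maximal iff every empty row has a smaller index than every empty column,
as the square of a pair violating this could be added. If \<open>k > 0\<close>, let \<open>i\<close>
be the largest index of an empty row. Then the columns \<open>1, \<dots>, i\<close> and the rows
\<open>i + 1, \<dots>, n\<close> are all occupied, and the placement splits into three parts:
\<open>i - k\<close> rooks in the triangle of rows below \<open>i\<close>, \<open>n - i - k\<close>
rooks in the triangle of columns above \<open>i\<close>, and a perfect matching between the
\<open>k\<close> remaining columns up to \<open>i\<close> and the \<open>k\<close> remaining rows
above \<open>i\<close>. The first two parts are counted by Stirling numbers, since the rook numbers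
of a triangle satisfy the Stirling recurrence; the third one by \<open>k!\<close>.\<close>

section \<open>Placements with a given number of rooks on an arbitrary board\<close>

definition placements :: "(nat \<times> nat) set \<Rightarrow> nat \<Rightarrow> (nat \<times> nat) set set" where
  "placements B r = {P. rook_placement B P \<and> card P = r}"

lemma rook_placement_iff:
  "rook_placement B P \<longleftrightarrow> P \<subseteq> B \<and> inj_on fst P \<and> inj_on snd P"
  unfolding rook_placement_def inj_on_def by blast

lemma rook_placement_mem: "rook_placement B P \<Longrightarrow> p \<in> P \<Longrightarrow> p \<in> B"
  by (auto simp: rook_placement_iff)

lemma rook_placement_empty [simp]: "rook_placement B {}"
  by (simp add: rook_placement_def)

lemma rook_placement_finite: "rook_placement B P \<Longrightarrow> finite B \<Longrightarrow> finite P"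
  by (auto simp: rook_placement_iff intro: finite_subset)

lemma rook_placement_insert:
  assumes "(c, j) \<notin> P"
  shows "rook_placement B (insert (c, j) P) \<longleftrightarrow>
    rook_placement B P \<and> (c, j) \<in> B \<and> c \<notin> fst ` P \<and> j \<notin> snd ` P"
  using assms by (auto simp: rook_placement_iff)

lemma rook_placement_subset:
  "rook_placement B P \<Longrightarrow> Q \<subseteq> P \<Longrightarrow> Q \<subseteq> B' \<Longrightarrow> rook_placement B' Q"
  unfolding rook_placement_def by blast

lemma finite_placements: "finite B \<Longrightarrow> finite (placements B r)"
  by (rule finite_subset[of _ "Pow B"]) (auto simp: placements_def rook_placement_iff)

lemma placements_0: "finite B \<Longrightarrow> placements B 0 = {{}}"
  by (auto simp: placements_def dest: rook_placement_finite)

lemma card_fst_placement: "rook_placement B P \<Longrightarrow> card (fst ` P) = card P"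
  by (simp add: rook_placement_iff card_image)

lemma card_snd_placement: "rook_placement B P \<Longrightarrow> card (snd ` P) = card P"
  by (simp add: rook_placement_iff card_image)

text \<open>Rooks stand in distinct rows, so they cannot outnumber the rows. This settles the
  boundary terms of the row recurrences.\<close>

lemma placements_few_rows:
  assumes "finite R" "snd ` B \<subseteq> R" "card R < r"
  shows "placements B r = {}"
proof -
  have "card P \<le> card R" if "rook_placement B P" for P
  proof -
    have "snd ` P \<subseteq> R" using that assms(2) by (auto simp: rook_placement_iff)
    then have "card (snd ` P) \<le> card R" by (rule card_mono[OF assms(1)])
    then show ?thesis by (simp add: card_snd_placement[OF that])
  qed
  then show ?thesis using assms(3) by (force simp: placements_def)
qed

section \<open>Counting row by row\<close>

text \<open>The new row is either empty or holds one rook, in a column free of the \<open>r\<close>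
  others. As all columns of \<open>B\<close> lie in \<open>C\<close>, those \<open>r\<close> rooks
  block exactly \<open>r\<close> columns of \<open>C\<close>, so the number of choices is the same
  for every smaller placement.\<close>

lemma card_placements_add_row:
  assumes B: "finite B" and C: "finite C" "fst ` B \<subseteq> C" and j: "j \<notin> snd ` B"
  shows "card (placements (B \<union> C \<times> {j}) (Suc r)) =
    card (placements B (Suc r)) + (card C - r) * card (placements B r)"
proof -
  let ?S = "SIGMA Q:placements B r. C - fst ` Q"
  let ?f = "\<lambda>(Q, c). insert (c, j) Q"
  have notin: "(c, j) \<notin> Q" "j \<notin> snd ` Q" "finite Q" "Q \<subseteq> B"
    if "rook_placement B Q" for Q c
    using that j rook_placement_finite[OF that B] by (force simp: rook_placement_iff)+
  have eq: "placements (B \<union> C \<times> {j}) (Suc r) = placements B (Suc r) \<union> ?f ` ?S" (is "?L = ?R")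
  proof
    show "?L \<subseteq> ?R"
    proof
      fix P assume "P \<in> ?L"
      then have P: "rook_placement (B \<union> C \<times> {j}) P" "card P = Suc r" "finite P"
        using B C rook_placement_finite by (auto simp: placements_def)
      show "P \<in> ?R"
      proof (cases "j \<in> snd ` P")
        case True
        then obtain c where c: "(c, j) \<in> P" by force
        define Q where "Q = P - {(c, j)}"
        have PQ: "P = insert (c, j) Q" "(c, j) \<notin> Q" using c by (auto simp: Q_def)
        have Q: "rook_placement (B \<union> C \<times> {j}) Q" "c \<notin> fst ` Q" "j \<notin> snd ` Q" "(c, j) \<in> B \<union> C \<times> {j}"
          using P(1) PQ by (auto simp: rook_placement_insert)
        have "Q \<subseteq> B" using Q(1,3) by (force simp: rook_placement_iff)
        then have "rook_placement B Q" using Q(1) by (simp add: rook_placement_iff)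
        moreover have "card Q = r" using P(2,3) PQ by simp
        moreover have "c \<in> C" using Q(4) j by force
        ultimately have "(Q, c) \<in> ?S" using Q(2) by (simp add: placements_def)
        then show ?thesis using PQ(1) by force
      next
        case False
        then have "P \<subseteq> B" using P(1) by (force simp: rook_placement_iff)
        then show ?thesis using P by (simp add: placements_def rook_placement_iff)
      qed
    qed
    show "?R \<subseteq> ?L"
    proof
      fix P assume "P \<in> ?R"
      then consider "P \<in> placements B (Suc r)" | Q c where "(Q, c) \<in> ?S" "P = insert (c, j) Q"
        by auto
      then show "P \<in> ?L"
      proof cases
        case 1
        then show ?thesis by (auto simp: placements_def rook_placement_iff)
      next
        case 2
        then have Q: "rook_placement B Q" "card Q = r" "c \<in> C" "c \<notin> fst ` Q"
          by (auto simp: placements_def)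
        have "rook_placement (B \<union> C \<times> {j}) Q" using Q(1) by (auto simp: rook_placement_iff)
        then show ?thesis
          using 2 Q notin[OF Q(1)] by (simp add: placements_def rook_placement_insert)
      qed
    qed
  qed
  \<comment> \<open>Row \<open>j\<close> does not meet \<open>B\<close>, so the rook added in row
    \<open>j\<close> can be recognised; removing it recovers \<open>Q\<close>.\<close>
  have inj: "inj_on ?f ?S"
  proof (rule inj_onI, clarsimp simp: placements_def)
    fix Q c Q' c'
    assume *: "rook_placement B Q" "rook_placement B Q'" "insert (c, j) Q = insert (c', j) Q'"
    then have "(c, j) \<notin> Q'" "(c', j) \<notin> Q" "(c, j) \<notin> Q" "(c', j) \<notin> Q'" using notin(1) by blast+
    moreover have "c = c'" using *(3) \<open>(c, j) \<notin> Q'\<close> by blast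
    ultimately show "Q = Q' \<and> c = c'" using *(3) by (simp add: insert_ident)
  qed
  have "card ?S = (\<Sum>Q\<in>placements B r. card (C - fst ` Q))"
    using finite_placements[OF B] C(1) by simp
  also have "\<dots> = (\<Sum>Q\<in>placements B r. card C - r)"
  proof (rule sum.cong[OF refl])
    fix Q assume "Q \<in> placements B r"
    then have Q: "rook_placement B Q" "card Q = r" by (auto simp: placements_def)
    have "fst ` Q \<subseteq> C" using notin(4)[OF Q(1)] C(2) by blast
    then show "card (C - fst ` Q) = card C - r"
      using card_fst_placement[OF Q(1)] Q(2) notin(3)[OF Q(1)] by (simp add: card_Diff_subset)
  qed
  finally have cardS: "card (?f ` ?S) = (card C - r) * card (placements B r)"
    by (simp add: card_image[OF inj])
  have "placements B (Suc r) \<inter> ?f ` ?S = {}"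
    using notin(2) by (fastforce simp: placements_def)
  moreover have "finite ?S" using finite_placements[OF B] C(1) by blast
  ultimately show ?thesis
    unfolding eq using cardS finite_placements[OF B] by (simp add: card_Un_disjoint)
qed

text \<open>Each filled row leaves one column fewer for the next, which gives a falling factorial;
  the factor on the left avoids a division. For equal sides the count is
  \<open>fact (card A)\<close>, the number of perfect matchings.\<close>

lemma card_placements_rectangle:
  assumes A: "finite A" and "finite R" and "card R \<le> card A"
  shows "card (placements (A \<times> R) (card R)) * fact (card A - card R) = fact (card A)"
  using assms(2,3)
proof (induction R rule: finite_induct)
  case empty
  then show ?case by (simp add: placements_0)
next
  case (insert j R)
  \<comment> \<open>One rook more than there are rows in \<open>R\<close> forces the new row to be
    occupied, so only the product term of the recurrence survives.\<close>
  have few: "placements (A \<times> R) (Suc (card R)) = {}"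
    by (rule placements_few_rows[OF insert.hyps(1)]) auto
  have "A \<times> insert j R = A \<times> R \<union> A \<times> {j}" by auto
  moreover have "card (placements (A \<times> R \<union> A \<times> {j}) (Suc (card R))) =
      (card A - card R) * card (placements (A \<times> R) (card R))"
    using insert.hyps A by (subst card_placements_add_row) (auto simp: few)
  ultimately have "card (placements (A \<times> insert j R) (card (insert j R))) =
      (card A - card R) * card (placements (A \<times> R) (card R))"
    using insert.hyps by simp
  moreover have "fact (card A - card R) =
      (card A - card R) * (fact (card A - card (insert j R)) :: nat)"
  proof -
    have "card A - card R = Suc (card A - card (insert j R))" using insert by simp
    then show ?thesis by (metis fact_Suc of_nat_id)
  qed
  ultimately show ?case using insert by (simp add: algebra_simps)
qed

section \<open>Rook numbers of triangles as Stirling numbers\<close>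

text \<open>The board moved along the diagonal. The offset \<open>a\<close> serves the part of a
  placement in the columns beyond \<open>i\<close>, which is again a triangle.\<close>

definition triangle :: "nat \<Rightarrow> nat \<Rightarrow> (nat \<times> nat) set" where
  "triangle a b = {(i, j). a < i \<and> i \<le> j \<and> j \<le> b}"

lemma triangular_board_eq: "triangular_board n = triangle 0 n"
  by (auto simp: triangular_board_def triangle_def)

lemma finite_triangle [simp]: "finite (triangle a b)"
  by (rule finite_subset[of _ "{..b} \<times> {..b}"]) (auto simp: triangle_def)

lemma triangle_rows: "snd ` triangle a b \<subseteq> {a<..b}"
  by (auto simp: triangle_def)

text \<open>Adding the longest row reproduces S(m+2, k+1) = S(m+1, k) + (k+1) S(m+1, k+1): the first
  term counts placements with that row empty, and otherwise \<open>m - k\<close> rooks leave k+1 of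
  its m+1 squares free.\<close>

lemma card_placements_triangle:
  "k \<le> m \<Longrightarrow> card (placements (triangle a (a + m)) (m - k)) = Stirling (Suc m) (Suc k)"
proof (induction m arbitrary: k)
  case 0
  then show ?case by (simp add: placements_0)
next
  case (Suc m)
  let ?T = "triangle a (a + m)" and ?C = "{a<..Suc (a + m)}"
  show ?case
  proof (cases "k = Suc m")
    case True
    then show ?thesis by (simp add: placements_0 del: Stirling.simps)
  next
    case False
    then have k: "k \<le> m" using Suc.prems by simp
    have "triangle a (a + Suc m) = ?T \<union> ?C \<times> {Suc (a + m)}"
      by (auto simp: triangle_def)
    moreover have "Suc m - k = Suc (m - k)" using k by simp
    moreover have "card (placements (?T \<union> ?C \<times> {Suc (a + m)}) (Suc (m - k))) =
        card (placements ?T (Suc (m - k))) + (card ?C - (m - k)) * card (placements ?T (m - k))"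
      by (rule card_placements_add_row) (simp, simp, auto simp: triangle_def)
    moreover have "card ?C - (m - k) = Suc k" using k by simp
    \<comment> \<open>For \<open>k = 0\<close> this asks for m+1 rooks in m rows, and both sides
      vanish; otherwise it is the induction hypothesis at \<open>k - 1\<close>.\<close>
    moreover have "card (placements ?T (Suc (m - k))) = Stirling (Suc m) k"
    proof (cases k)
      case 0
      then have "placements ?T (Suc (m - k)) = {}"
        by (intro placements_few_rows[OF _ triangle_rows]) auto
      then show ?thesis using 0 by simp
    next
      case (Suc l)
      then have "Suc (m - k) = m - l" "l \<le> m" using k by auto
      then show ?thesis using Suc.IH[of l] Suc by simp
    qed
    ultimately show ?thesis using Suc.IH[OF k] by simp
  qed
qed

section \<open>Maximal placements sorted by their largest empty row\<close>

text \<open>A square can be added exactly if its column and its row are both empty. Squares of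
  \<open>P\<close> satisfy the condition trivially, so it may range over all of
  \<open>B\<close>.\<close>

lemma maximal_rook_placement_iff:
  "maximal_rook_placement B P \<longleftrightarrow>
    rook_placement B P \<and> (\<forall>(c, j)\<in>B. c \<in> fst ` P \<or> j \<in> snd ` P)"
proof -
  have "c \<in> fst ` P \<or> j \<in> snd ` P" if "(c, j) \<in> P" for c j
    using that by force
  then have "((c, j) \<in> P \<or> \<not> rook_placement B (insert (c, j) P)) \<longleftrightarrow> c \<in> fst ` P \<or> j \<in> snd ` P"
    if "rook_placement B P" "(c, j) \<in> B" for c j
    using that rook_placement_insert[of c j P B] by blast
  then have "(\<forall>s\<in>B - P. \<not> rook_placement B (insert s P)) \<longleftrightarrow>
      (\<forall>(c, j)\<in>B. c \<in> fst ` P \<or> j \<in> snd ` P)" if "rook_placement B P"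
    using that unfolding Ball_def split_paired_All Diff_iff prod.case by blast
  then show ?thesis unfolding maximal_rook_placement_def by blast
qed

text \<open>Here \<open>i\<close> plays the largest empty row; given that, occupation of the columns
  up to \<open>i\<close> is what maximality amounts to.\<close>

definition split_placements :: "nat \<Rightarrow> nat \<Rightarrow> nat \<Rightarrow> (nat \<times> nat) set set" where
  "split_placements n r i = {P \<in> placements (triangle 0 n) r.
     i \<notin> snd ` P \<and> {i<..n} \<subseteq> snd ` P \<and> {0<..i} \<subseteq> fst ` P}"

text \<open>There are \<open>k\<close> empty rows, and \<open>k > 0\<close> provides a largest one,
  \<open>i\<close>. The \<open>k\<close> empty rows lie in \<open>{0<..i}\<close> and the
  \<open>k\<close> empty columns in \<open>{i<..n}\<close>, whence the range of
  \<open>i\<close>.\<close>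

lemma maximal_placements_eq_UN_split:
  assumes "k > 0" "k \<le> n"
  shows "{P. maximal_rook_placement (triangular_board n) P \<and> card P = n - k} =
    (\<Union>i\<in>{k..n - k}. split_placements n (n - k) i)" (is "?L = ?R")
proof
  show "?L \<subseteq> ?R"
  proof
    fix P assume "P \<in> ?L"
    then have P: "rook_placement (triangle 0 n) P" "card P = n - k"
      and max: "\<And>c j. (c, j) \<in> triangle 0 n \<Longrightarrow> c \<in> fst ` P \<or> j \<in> snd ` P"
      by (auto simp: maximal_rook_placement_iff triangular_board_eq)
    define R where "R = {0<..n} - snd ` P"
    define C where "C = {0<..n} - fst ` P"
    have fin: "finite P" using P(1) rook_placement_finite by auto
    have sub: "snd ` P \<subseteq> {0<..n}" "fst ` P \<subseteq> {0<..n}"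
      using P(1) by (auto simp: rook_placement_iff triangle_def)
    have cR: "card R = k" using sub fin card_snd_placement[OF P(1)] P(2) assms(2)
      by (simp add: R_def card_Diff_subset)
    have cC: "card C = k" using sub fin card_fst_placement[OF P(1)] P(2) assms(2)
      by (simp add: C_def card_Diff_subset)
    have finR: "finite R" "R \<noteq> {}" using cR assms(1) by (auto intro: card_ge_0_finite)
    define i where "i = Max R"
    have i: "i \<in> R" "\<And>j. j \<in> R \<Longrightarrow> j \<le> i" using finR by (auto simp: i_def)
    have Rsub: "R \<subseteq> {0<..i}" using i by (auto simp: R_def)
    \<comment> \<open>An empty column \<open>c \<le> i\<close> would meet the empty row
      \<open>i\<close> in a square of the board, against maximality.\<close>
    have Csub: "C \<subseteq> {i<..n}"
    proof
      fix c assume c: "c \<in> C"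
      have "\<not> c \<le> i"
      proof
        assume "c \<le> i"
        then have "(c, i) \<in> triangle 0 n" using c i(1) by (auto simp: triangle_def C_def R_def)
        with max c i(1) show False by (auto simp: C_def R_def)
      qed
      then show "c \<in> {i<..n}" using c by (auto simp: C_def)
    qed
    have "k \<le> i" using card_mono[OF _ Rsub] cR by simp
    moreover have "k \<le> n - i" using card_mono[OF _ Csub] cC by simp
    ultimately have i_mem: "i \<in> {k..n - k}" using assms by simp
    have "i \<le> n" using i(1) by (simp add: R_def)
    have "{i<..n} \<subseteq> snd ` P"
    proof
      fix j assume j: "j \<in> {i<..n}"
      then have "j \<notin> R" using i(2)[of j] by auto
      then show "j \<in> snd ` P" using j by (simp add: R_def)
    qed
    moreover have "{0<..i} \<subseteq> fst ` P"
    proof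
      fix c assume c: "c \<in> {0<..i}"
      then have "c \<notin> C" using Csub by auto
      then show "c \<in> fst ` P" using c \<open>i \<le> n\<close> by (simp add: C_def)
    qed
    moreover have "i \<notin> snd ` P" using i(1) by (simp add: R_def)
    ultimately have "P \<in> split_placements n (n - k) i"
      using P by (simp add: split_placements_def placements_def)
    with i_mem show "P \<in> ?R" by (rule UN_I)
  qed
  show "?R \<subseteq> ?L"
  proof
    fix P assume "P \<in> ?R"
    then obtain i where "P \<in> split_placements n (n - k) i" by blast
    then have P: "rook_placement (triangle 0 n) P" "card P = n - k"
      and cov: "{i<..n} \<subseteq> snd ` P" "{0<..i} \<subseteq> fst ` P"
      by (auto simp: split_placements_def placements_def)
    \<comment> \<open>A square on the board has \<open>c \<le> j\<close>, so either its column is at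
      most \<open>i\<close> or its row is beyond \<open>i\<close>; both kinds are occupied.\<close>
    have "c \<in> fst ` P \<or> j \<in> snd ` P" if "(c, j) \<in> triangle 0 n" for c j
    proof (cases "c \<le> i")
      case True
      then have "c \<in> {0<..i}" using that by (simp add: triangle_def)
      then show ?thesis using cov by blast
    next
      case False
      then have "j \<in> {i<..n}" using that by (simp add: triangle_def)
      then show ?thesis using cov by blast
    qed
    then show "P \<in> ?L" using P by (auto simp: maximal_rook_placement_iff triangular_board_eq)
  qed
qed

text \<open>For \<open>i < j\<close>, row \<open>j\<close> is occupied in the first family and empty
  in the second.\<close>

lemma disjoint_split_placements:
  assumes "i \<in> {0<..n}" "j \<in> {0<..n}" "i \<noteq> j"
  shows "split_placements n r i \<inter> split_placements n r j = {}"
proof -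
  have *: "split_placements n r i \<inter> split_placements n r j = {}" if "i < j" "j \<le> n" for i j
    using that by (auto simp: split_placements_def dest: subsetD[of _ _ j])
  show ?thesis using *[of i j] *[of j i] assms by (cases i j rule: linorder_cases) auto
qed

section \<open>Splitting a placement at its largest empty row\<close>

text \<open>Every pair of a column up to \<open>i\<close> and a row beyond \<open>i\<close> is a
  square of the board, so what \<open>Q\<close> and \<open>T\<close> leave over is a full
  rectangle.\<close>

definition gap_board :: "nat \<Rightarrow> nat \<Rightarrow> (nat \<times> nat) set \<Rightarrow> (nat \<times> nat) set \<Rightarrow> (nat \<times> nat) set" where
  "gap_board n i Q T = ({0<..i} - fst ` Q) \<times> ({i<..n} - snd ` T)"

text \<open>The three parts occupy disjoint regions and are recovered by restriction. The first
  triangle ends at \<open>i - 1\<close> because row \<open>i\<close> is empty and a rook in a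
  smaller row has a column below \<open>i\<close> too.\<close>

lemma bij_betw_split_placements:
  assumes k: "k > 0" "k \<le> i" "i \<le> n - k"
  shows "bij_betw (\<lambda>(Q, T, M). Q \<union> T \<union> M)
    (SIGMA Q:placements (triangle 0 (i - 1)) (i - k).
     SIGMA T:placements (triangle i n) (n - i - k). placements (gap_board n i Q T) k)
    (split_placements n (n - k) i)" (is "bij_betw ?f ?S ?X")
proof -
  \<comment> \<open>The weak inequality \<open>i \<le> snd p\<close> makes the three regions cover
    all pairs; on placements with row \<open>i\<close> empty it is strict.\<close>
  let ?g = "\<lambda>P. (P \<inter> {p. snd p < i}, P \<inter> {p. i < fst p}, P \<inter> {p. fst p \<le> i \<and> i \<le> snd p})"
  have S: "?g (?f (Q, T, M)) = (Q, T, M) \<and> ?f (Q, T, M) \<in> ?X" if "(Q, T, M) \<in> ?S" for Q T M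
  proof -
    let ?P = "Q \<union> T \<union> M"
    have Q: "rook_placement (triangle 0 (i - 1)) Q" "card Q = i - k"
      and T: "rook_placement (triangle i n) T" "card T = n - i - k"
      and M: "rook_placement (gap_board n i Q T) M" "card M = k"
      using that by (auto simp: placements_def)
    have Qb: "0 < c \<and> c \<le> j \<and> j < i" if "(c, j) \<in> Q" for c j
      using rook_placement_mem[OF Q(1) that] k by (auto simp: triangle_def)
    have Tb: "i < c \<and> c \<le> j \<and> j \<le> n" if "(c, j) \<in> T" for c j
      using rook_placement_mem[OF T(1) that] by (auto simp: triangle_def)
    have Mb: "0 < c \<and> c \<le> i \<and> c \<notin> fst ` Q \<and> i < j \<and> j \<le> n \<and> j \<notin> snd ` T"
      if "(c, j) \<in> M" for c j
      using rook_placement_mem[OF M(1) that] by (simp add: gap_board_def)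
    have fin: "finite Q" "finite T" "finite M"
      using Q T M by (auto intro: rook_placement_finite simp: gap_board_def)
    have sub: "fst ` Q \<subseteq> {0<..i}" "snd ` Q \<subseteq> {0<..<i}" "fst ` T \<subseteq> {i<..n}" "snd ` T \<subseteq> {i<..n}"
      by (auto dest: Qb Tb)
    have "fst ` M \<subseteq> A \<and> snd ` M \<subseteq> B" if "M \<subseteq> A \<times> B" for A B
      using that by auto
    then have subM: "fst ` M \<subseteq> {0<..i} - fst ` Q" "snd ` M \<subseteq> {i<..n} - snd ` T"
      using M(1) unfolding rook_placement_iff gap_board_def by blast+
    have ivl: "{0<..i} \<inter> {i<..n} = {}" "{0<..<i} \<inter> {i<..n} = {}" by auto
    have fdisj: "fst ` Q \<inter> fst ` T = {}" "fst ` (Q \<union> T) \<inter> fst ` M = {}"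
      unfolding image_Un using sub(1,3) subM(1) ivl(1) by blast+
    have sdisj: "snd ` Q \<inter> snd ` T = {}" "snd ` (Q \<union> T) \<inter> snd ` M = {}"
      unfolding image_Un using sub(2,4) subM(2) ivl(2) by blast+
    have disj: "Q \<inter> T = {}" "(Q \<union> T) \<inter> M = {}"
      using fdisj by blast+
    have "card ?P = n - k" using disj fin Q T M k by (simp add: card_Un_disjoint)
    moreover have "rook_placement (triangle 0 n) ?P"
      unfolding rook_placement_iff
    proof (intro conjI)
      show "?P \<subseteq> triangle 0 n" using k by (auto simp: triangle_def dest!: Qb Tb Mb)
      have "f ` Q \<inter> f ` T = {} \<Longrightarrow> f ` (Q \<union> T) \<inter> f ` M = {} \<Longrightarrow>
          inj_on f Q \<Longrightarrow> inj_on f T \<Longrightarrow> inj_on f M \<Longrightarrow> inj_on f ?P" for f :: "nat \<times> nat \<Rightarrow> nat"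
        unfolding inj_on_Un by blast
      then show "inj_on fst ?P" "inj_on snd ?P"
        using Q(1) T(1) M(1) fdisj sdisj by (simp_all only: rook_placement_iff)
    qed
    moreover have "i \<notin> snd ` ?P" unfolding image_Un using sub(2,4) subM(2) by auto
    moreover have "{i<..n} \<subseteq> snd ` ?P"
    proof -
      \<comment> \<open>\<open>T\<close> misses exactly \<open>k\<close> rows beyond
        \<open>i\<close>, and the \<open>k\<close> rooks of \<open>M\<close> stand in distinct ones
        among them, hence in all. The columns up to \<open>i\<close> are treated alike.\<close>
      have "card ({i<..n} - snd ` T) = k"
        using sub(4) card_snd_placement[OF T(1)] T(2) fin k by (simp add: card_Diff_subset)
      then have "snd ` M = {i<..n} - snd ` T"
        using subM(2) card_snd_placement[OF M(1)] M(2) by (intro card_subset_eq) auto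
      then show ?thesis by blast
    qed
    moreover have "{0<..i} \<subseteq> fst ` ?P"
    proof -
      have "card ({0<..i} - fst ` Q) = k"
        using sub(1) card_fst_placement[OF Q(1)] Q(2) fin k by (simp add: card_Diff_subset)
      then have "fst ` M = {0<..i} - fst ` Q"
        using subM(1) card_fst_placement[OF M(1)] M(2) by (intro card_subset_eq) auto
      then show ?thesis by blast
    qed
    moreover have "?P \<inter> {p. snd p < i} = Q" "?P \<inter> {p. i < fst p} = T"
      "?P \<inter> {p. fst p \<le> i \<and> i \<le> snd p} = M"
      by (auto dest: Qb Tb Mb)
    ultimately show ?thesis by (simp add: split_placements_def placements_def)
  qed
  have X: "?f (?g P) = P \<and> ?g P \<in> ?S" if "P \<in> ?X" for P
  proof -
    define Q where "Q = P \<inter> {p. snd p < i}"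
    define T where "T = P \<inter> {p. i < fst p}"
    define M where "M = P \<inter> {p. fst p \<le> i \<and> i \<le> snd p}"
    have P: "rook_placement (triangle 0 n) P" "card P = n - k" and i: "i \<notin> snd ` P"
      and cov: "{i<..n} \<subseteq> snd ` P" "{0<..i} \<subseteq> fst ` P"
      using that by (auto simp: split_placements_def placements_def)
    have fin: "finite P" using P(1) rook_placement_finite by auto
    have Pb: "0 < c \<and> c \<le> j \<and> j \<le> n \<and> j \<noteq> i" if "(c, j) \<in> P" for c j
      using rook_placement_mem[OF P(1) that] i that by (force simp: triangle_def)
    have PQTM: "P = Q \<union> T \<union> M" by (auto simp: Q_def T_def M_def)
    have disj: "Q \<inter> T = {}" "(Q \<union> T) \<inter> M = {}"
      by (auto simp: Q_def T_def M_def dest: Pb)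
    have finQTM: "finite Q" "finite T" "finite M" using fin PQTM by auto
    have inj: "inj_on fst P" "inj_on snd P" using P(1) by (auto simp: rook_placement_iff)
    have injs: "inj_on fst (Q \<union> M)" "inj_on snd (T \<union> M)"
      using inj PQTM by (auto intro: inj_on_subset)
    have fQM: "fst ` (Q \<union> M) = {0<..i}"
    proof
      show "fst ` (Q \<union> M) \<subseteq> {0<..i}" by (auto simp: Q_def M_def dest: Pb)
      show "{0<..i} \<subseteq> fst ` (Q \<union> M)"
      proof
        fix c assume c: "c \<in> {0<..i}"
        then have "c \<in> fst ` P" using cov(2) by blast
        then obtain j where j: "(c, j) \<in> P" by auto
        then have "(c, j) \<in> Q \<union> M" using c by (auto simp add: Q_def M_def)
        then show "c \<in> fst ` (Q \<union> M)" by (rule rev_image_eqI) simp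
      qed
    qed
    have sTM: "snd ` (T \<union> M) = {i<..n}"
    proof
      show "snd ` (T \<union> M) \<subseteq> {i<..n}" by (auto simp: T_def M_def dest: Pb)
      show "{i<..n} \<subseteq> snd ` (T \<union> M)"
      proof
        fix j assume j: "j \<in> {i<..n}"
        then have "j \<in> snd ` P" using cov(1) by blast
        then obtain c where c: "(c, j) \<in> P" by auto
        then have "(c, j) \<in> T \<union> M" using j by (auto simp add: T_def M_def)
        then show "j \<in> snd ` (T \<union> M)" by (rule rev_image_eqI) simp
      qed
    qed
    \<comment> \<open>\<open>Q\<close> and \<open>M\<close> together fill the columns up to
      \<open>i\<close>, \<open>T\<close> and \<open>M\<close> the rows beyond \<open>i\<close>. With
      the total \<open>n - k\<close>, these equations determine the three sizes.\<close>
    have "card Q + card M = i" "card T + card M = n - i"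
      using card_image[OF injs(1)] card_image[OF injs(2)] fQM sTM disj finQTM
      by (simp_all add: card_Un_disjoint Int_Un_distrib2)
    moreover have "card Q + card T + card M = n - k"
      using P(2) PQTM disj finQTM by (simp add: card_Un_disjoint)
    ultimately have cards: "card M = k" "card Q = i - k" "card T = n - i - k" using k by auto
    have "rook_placement (triangle 0 (i - 1)) Q" "rook_placement (triangle i n) T"
      by (rule rook_placement_subset[OF P(1)]; force simp: Q_def T_def triangle_def dest: Pb)+
    moreover have "rook_placement (gap_board n i Q T) M"
    proof (rule rook_placement_subset[OF P(1)])
      show "M \<subseteq> P" by (simp add: M_def)
      \<comment> \<open>Disjoint parts of a placement have disjoint sets of columns and of rows, by
        injectivity of the projections.\<close>
      have "fst ` Q \<inter> fst ` M = {}" "snd ` T \<inter> snd ` M = {}"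
        using inj_on_image_Int[OF injs(1), of Q M] inj_on_image_Int[OF injs(2), of T M] disj(2)
        by (auto simp: Int_Un_distrib2)
      moreover have "Y \<subseteq> Z - X" if "X \<union> Y = Z" "X \<inter> Y = {}" for X Y Z :: "nat set"
        using that by blast
      ultimately have "fst ` M \<subseteq> {0<..i} - fst ` Q" "snd ` M \<subseteq> {i<..n} - snd ` T"
        using fQM sTM by (simp_all only: image_Un)
      then have "fst ` M \<times> snd ` M \<subseteq> gap_board n i Q T"
        unfolding gap_board_def by (rule Sigma_mono)
      with subset_fst_snd show "M \<subseteq> gap_board n i Q T"
        by (rule subset_trans)
    qed
    ultimately have "(Q, T, M) \<in> ?S" using cards by (simp add: placements_def)
    moreover have "?g P = (Q, T, M)" by (simp add: Q_def T_def M_def)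
    ultimately show ?thesis using PQTM by (metis (no_types, lifting) case_prod_conv)
  qed
  show ?thesis
    by (rule bij_betw_byWitness[where f' = ?g]) (use S X in \<open>fast+\<close>)
qed

text \<open>The gap rectangle always has sides \<open>k\<close>, so it contributes
  \<open>fact k\<close> whatever \<open>Q\<close> and \<open>T\<close> are, and the dependent sum
  becomes a product.\<close>

lemma card_split_placements:
  assumes k: "k > 0" "k \<le> i" "i \<le> n - k"
  shows "card (split_placements n (n - k) i) =
    fact k * (Stirling i k * Stirling (n + 1 - i) (k + 1))"
proof -
  let ?A = "placements (triangle 0 (i - 1)) (i - k)"
  let ?B = "placements (triangle i n) (n - i - k)"
  have gap: "card (placements (gap_board n i Q T) k) = fact k" if "Q \<in> ?A" "T \<in> ?B" for Q T
  proof -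
    have Q: "rook_placement (triangle 0 (i - 1)) Q" "card Q = i - k"
      and T: "rook_placement (triangle i n) T" "card T = n - i - k"
      using that by (auto simp: placements_def)
    have fin: "finite Q" "finite T" using Q T by (auto intro: rook_placement_finite)
    have "fst ` Q \<subseteq> {0<..i}" "snd ` T \<subseteq> {i<..n}"
      using Q(1) T(1) by (fastforce simp: rook_placement_iff triangle_def)+
    then have "card ({0<..i} - fst ` Q) = k" "card ({i<..n} - snd ` T) = k"
      using card_fst_placement[OF Q(1)] card_snd_placement[OF T(1)] Q(2) T(2) fin k
      by (simp_all add: card_Diff_subset)
    then show ?thesis
      using card_placements_rectangle[of "{0<..i} - fst ` Q" "{i<..n} - snd ` T"]
      by (simp add: gap_board_def)
  qed
  \<comment> \<open>The triangle of size \<open>i - 1\<close> takes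
    \<open>i - k = (i - 1) - (k - 1)\<close> rooks; \<open>k > 0\<close> makes the shift
    harmless.\<close>
  have "card ?A = Stirling i k"
    using card_placements_triangle[of "k - 1" "i - 1" 0] k by simp
  moreover have "card ?B = Stirling (n + 1 - i) (k + 1)"
    using card_placements_triangle[of k "n - i" i] k by (simp add: Suc_diff_le del: Stirling.simps)
  moreover have "card (split_placements n (n - k) i) =
      card (SIGMA Q:?A. SIGMA T:?B. placements (gap_board n i Q T) k)"
    using bij_betw_same_card[OF bij_betw_split_placements[OF k]] by simp
  moreover have "\<dots> = card ?A * (card ?B * fact k)"
  proof -
    have "finite (placements (gap_board n i Q T) k)" for Q T
      by (rule finite_placements) (simp add: gap_board_def)
    then show ?thesis by (simp add: gap finite_placements)
  qed
  ultimately show ?thesis by simp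
qed

section \<open>The case without empty rows, and the summation\<close>

text \<open>With \<open>n\<close> rooks every row is occupied, so maximality is automatic and the
  count is S(n+1, 1) = 1.\<close>

lemma num_maximal_placements_full: "num_maximal_placements n n = 1"
proof -
  have "maximal_rook_placement (triangle 0 n) P" if P: "P \<in> placements (triangle 0 n) n" for P
  proof -
    have r: "rook_placement (triangle 0 n) P" "card P = n" using P by (auto simp: placements_def)
    have "snd ` P \<subseteq> {0<..n}" using r(1) by (auto simp: rook_placement_iff triangle_def)
    then have "snd ` P = {0<..n}"
      using card_snd_placement[OF r(1)] r(2) by (intro card_subset_eq) auto
    then show ?thesis using r(1) by (auto simp: maximal_rook_placement_iff triangle_def)
  qed
  then have "{P. maximal_rook_placement (triangular_board n) P \<and> card P = n} =
      placements (triangle 0 n) n"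
    unfolding placements_def triangular_board_eq by (auto simp: maximal_rook_placement_def)
  then show ?thesis
    using card_placements_triangle[of 0 n 0] by (simp add: num_maximal_placements_def del: Stirling.simps)
qed

theorem corollary4p6:
  fixes n k :: nat
  assumes "n \<ge> 1" and "k \<le> n"
  shows "num_maximal_placements n (n - k) =
           fact k * (\<Sum>i = k..n - k. Stirling i k * Stirling (n + 1 - i) (k + 1))"
proof (cases "k = 0")
  case True
  \<comment> \<open>Without an empty row there is nothing to split at. In the sum, S(i, 0) kills all
    terms but \<open>i = 0\<close>, where S(n+1, 1) = 1 remains.\<close>
  have "(\<Sum>i = 0..n. Stirling i 0 * Stirling (n + 1 - i) 1) =
      (\<Sum>i = 0..n. if i = 0 then 1 else 0)"
    by (rule sum.cong[OF refl]) (auto simp: gr0_conv_Suc simp del: Stirling.simps(4))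
  then show ?thesis using True by (simp add: num_maximal_placements_full)
next
  case False
  then have k: "k > 0" by simp
  have fin: "finite (split_placements n (n - k) i)" for i
    unfolding split_placements_def by (simp add: finite_placements)
  have "num_maximal_placements n (n - k) = card (\<Union>i\<in>{k..n - k}. split_placements n (n - k) i)"
    using k assms(2) by (simp add: num_maximal_placements_def maximal_placements_eq_UN_split)
  also have "\<dots> = (\<Sum>i = k..n - k. card (split_placements n (n - k) i))"
    \<comment> \<open>\<open>k > 0\<close> keeps the index range inside \<open>{0<..n}\<close>,
      where the families are disjoint.\<close>
    using fin k by (intro card_UN_disjoint ballI impI disjoint_split_placements) auto
  also have "\<dots> = (\<Sum>i = k..n - k. fact k * (Stirling i k * Stirling (n + 1 - i) (k + 1)))"
    using k by (intro sum.cong refl card_split_placements) auto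
  finally show ?thesis by (simp add: sum_distrib_left)
qed

end
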